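(* Let $t,t'\in\{0,1,\dots,T\}$ and $l\in\{0,1,\dots,L\}$, put $\Delta l=L-l$ and $\Delta t=t-t'$, and let $c$ be an index for all the shortest paths between opposite ends of a rectangular grid of sides $\Delta l$ and $\Delta t$. Then $$\frac1T\sum_{t=0}^{T}\ \sum_{t'\le t}\ \sum_{c}1=\frac1T\binom{T+\Delta l+2}{T},$$ and this quantity is sub-exponential in the two limits (i) $T\to\infty$, keeping $L$ fixed, and (ii) $L\to\infty$, keeping $T$ fixed, but is exponential in the limit (iii) where both $T$ and $L$ tend to infinity at the same rate.
   Context: Here $T\ge 1$ and $L\ge 0$ are integers, and $t'$ ranges over $0\le t'\le t$. A shortest path in a rectangular grid of integer sides $a,b$ is a lattice path from $(0,0)$ to $(a,b)$ consisting of unit steps in the two positive coordinate directions; the inner sum $\sum_c 1$ is therefore the number of such paths in the grid of sides $\Delta l$ and $t-t'$. In all three limits $l$ is held fixed. "Sub-exponential" and "exponential" describe the growth of the quantity in the parameter(s) tending to infinity: sub-exponential means growing more slowly than $c^n$ for every $c>1$, and exponential means growing exponentially. "At the same rate" means with the ratio $T/\Delta l$ kept fixed at a positive constant. *)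

theory Defs
  imports Complex_Main "HOL-Library.Landau_Symbols"
begin

definition unit_step :: "nat \<times> nat \<Rightarrow> nat \<times> nat \<Rightarrow> bool" where
  "unit_step p q \<longleftrightarrow> q = (Suc (fst p), snd p) \<or> q = (fst p, Suc (snd p))"

text \<open>A path is the list of the lattice points that it visits, both ends included.\<close>

definition shortest_paths :: "nat \<Rightarrow> nat \<Rightarrow> (nat \<times> nat) list set" where
  "shortest_paths a b =
     {ps. ps \<noteq> [] \<and> hd ps = (0, 0) \<and> last ps = (a, b) \<and> successively unit_step ps}"

text \<open>The subtraction is on natural numbers, so this is meant for \<^prop>\<open>l \<le> L\<close>.\<close>

definition mean_paths :: "nat \<Rightarrow> nat \<Rightarrow> nat \<Rightarrow> real" where
  "mean_paths T L l =
     1 / real T * (\<Sum>t = 0..T. \<Sum>t'\<le>t. \<Sum>c\<in>shortest_paths (L - l) (t - t'). 1)"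

text \<open>Growth of \<^term>\<open>f\<close> along the filter \<^term>\<open>F\<close>, measured in the parameter \<^term>\<open>n\<close>.
  Exponential growth is meant in the two-sided sense, that is, as
  \<open>exp (\<Theta>(n))\<close>.\<close>

definition subexponential :: "'a filter \<Rightarrow> ('a \<Rightarrow> nat) \<Rightarrow> ('a \<Rightarrow> real) \<Rightarrow> bool" where
  "subexponential F n f \<longleftrightarrow> (\<forall>c>1. f \<in> o[F](\<lambda>x. c ^ n x))"

definition exponential :: "'a filter \<Rightarrow> ('a \<Rightarrow> nat) \<Rightarrow> ('a \<Rightarrow> real) \<Rightarrow> bool" where
  "exponential F n f \<longleftrightarrow>
     (\<exists>a>1. f \<in> \<Omega>[F](\<lambda>x. a ^ n x)) \<and> (\<exists>b>1. f \<in> O[F](\<lambda>x. b ^ n x))"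

text \<open>Pairs \<open>(T, L)\<close> with both components tending to infinity while \<open>T / (L - l)\<close>
  is equal to \<^term>\<open>r\<close>. For irrational \<^term>\<open>r\<close> there are no such pairs and the filter
  is trivial; for positive rational \<^term>\<open>r\<close> it is proper, as shown below.\<close>

definition same_rate :: "nat \<Rightarrow> real \<Rightarrow> (nat \<times> nat) filter" where
  "same_rate l r =
     inf (at_top \<times>\<^sub>F at_top) (principal {(T, L). l \<le> L \<and> real T / real (L - l) = r})"

lemma same_rate_proper:
  assumes "r \<in> \<rat>" "r > 0"
  shows "same_rate l r \<noteq> bot"
proof
  assume bot: "same_rate l r = bot"
  obtain p q :: nat where pq: "q \<noteq> 0" "\<bar>r\<bar> = real p / real q"
    using Rats_abs_nat_div_natE[OF assms(1)] by metis
  with assms(2) have r: "r = real p / real q" and "p > 0" by (auto intro!: Nat.gr0I)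
  have "eventually (\<lambda>x. False) (same_rate l r)" by (simp add: bot)
  then have "eventually (\<lambda>(T, L). \<not> (l \<le> L \<and> real T / real (L - l) = r))
      (at_top \<times>\<^sub>F at_top)"
    unfolding same_rate_def eventually_inf_principal by (simp add: case_prod_unfold)
  then obtain N where N: "\<And>T L. T \<ge> N \<Longrightarrow> L \<ge> N \<Longrightarrow> \<not> (l \<le> L \<and> real T / real (L - l) = r)"
    unfolding eventually_prod_sequentially by auto
  define n where "n = Suc N"
  have "p * n \<ge> N" "l + q * n \<ge> N"
    using \<open>p > 0\<close> pq(1) mult_le_mono1[of 1 p n] mult_le_mono1[of 1 q n]
    by (auto simp: n_def)
  moreover have "n > 0" by (simp add: n_def)
  ultimately show False using N[of "p * n" "l + q * n"] by (simp add: r)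
qed

end

theory Submission
  imports Defs "HOL-Real_Asymp.Real_Asymp"
begin

text \<open>Classifying paths by their last step gives Pascal's recurrence, so the double sum collapses
  under the hockey-stick identity applied twice. For fixed \<open>T\<close> or fixed \<open>L\<close> the binomial
  coefficient is polynomially bounded through \<open>n choose k \<le> n ^ k\<close>. When \<open>T = r (L - l)\<close>
  it lies between \<open>(1 + 1 / r) ^ T\<close>, from \<open>n choose k \<ge> (n / k) ^ k\<close>, and
  \<open>2 ^ (T + (L - l) + 2)\<close>, and the factor \<open>1 / T\<close> costs only a smaller base.\<close>

text \<open>Deleting the last point leaves either the empty list, possible only when the end
  \<open>(a, b)\<close> is the origin where the path starts, or a path to a predecessor of
  \<open>(a, b)\<close>. Keeping the predecessors as a set treats the axes and the interior in one
  equation.\<close>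

lemma shortest_paths_eq:
  "shortest_paths a b =
     (if a = 0 \<and> b = 0 then {[(0, 0)]} else {}) \<union>
     (\<lambda>ps. ps @ [(a, b)]) ` (\<Union>(c, d)\<in>{p. unit_step p (a, b)}. shortest_paths c d)"
    (is "?L = ?R")
proof (intro equalityI subsetI)
  fix ps assume ps: "ps \<in> ?L"
  then obtain qs where qs: "ps = qs @ [(a, b)]"
    by (cases ps rule: rev_cases) (auto simp: shortest_paths_def)
  show "ps \<in> ?R"
  proof (cases "qs = []")
    case True
    with ps qs show ?thesis by (auto simp: shortest_paths_def)
  next
    case False
    obtain c d where cd: "last qs = (c, d)" by fastforce
    have "qs \<in> shortest_paths c d" "unit_step (c, d) (a, b)"
      using ps False cd unfolding qs shortest_paths_def by (auto simp: successively_append_iff)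
    then show ?thesis unfolding qs by blast
  qed
next
  fix ps assume "ps \<in> ?R"
  then show "ps \<in> ?L"
    by (auto simp: shortest_paths_def successively_append_iff split: if_splits)
qed

lemma unit_step_target:
  "{p. unit_step p (0, 0)} = {}"
  "{p. unit_step p (Suc a, 0)} = {(a, 0)}"
  "{p. unit_step p (0, Suc b)} = {(0, b)}"
  "{p. unit_step p (Suc a, Suc b)} = {(a, Suc b), (Suc a, b)}"
  by (auto simp: unit_step_def)

text \<open>Induction on the number of steps \<open>a + b\<close>; the last-step decomposition
  becomes Pascal's rule. Finiteness is carried along because cardinalities of disjoint unions add
  only for finite sets.\<close>

lemma finite_card_shortest_paths:
  "finite (shortest_paths a b) \<and> card (shortest_paths a b) = (a + b) choose b"
proof (induction "a + b" arbitrary: a b)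
  case 0
  then show ?case by (simp add: shortest_paths_eq[of 0 0] unit_step_target)
next
  case (Suc n)
  have inj: "inj_on (\<lambda>ps. ps @ [q]) A" for q :: "nat \<times> nat" and A by (simp add: inj_on_def)
  consider (right) a' where "a = Suc a'" "b = 0" | (up) b' where "a = 0" "b = Suc b'"
    | (both) a' b' where "a = Suc a'" "b = Suc b'"
    using Suc.hyps(2) by (cases a; cases b) auto
  then show ?case
  proof cases
    case right
    with Suc.hyps(1)[of a' 0] Suc.hyps(2) show ?thesis
      by (simp add: shortest_paths_eq[of "Suc a'" 0] unit_step_target card_image inj)
  next
    case up
    with Suc.hyps(1)[of 0 b'] Suc.hyps(2) show ?thesis
      by (simp add: shortest_paths_eq[of 0 "Suc b'"] unit_step_target card_image inj)
  next
    case both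
    \<comment> \<open>The two families end at different points, so their cardinalities add.\<close>
    have "shortest_paths a' (Suc b') \<inter> shortest_paths (Suc a') b' = {}"
      by (auto simp: shortest_paths_def)
    with both Suc.hyps(1)[of a' "Suc b'"] Suc.hyps(1)[of "Suc a'" b'] Suc.hyps(2) show ?thesis
      by (simp add: shortest_paths_eq[of "Suc a'" "Suc b'"] unit_step_target card_image inj
          card_Un_disjoint)
  qed
qed

lemma mean_paths_eq: "mean_paths T L l = 1 / real T * real ((T + (L - l) + 2) choose T)"
proof -
  define d where "d = L - l"
  have "(\<Sum>t'\<le>t. card (shortest_paths d (t - t'))) = (Suc d + t) choose t" for t
  proof -
    \<comment> \<open>Reversing the summation by \<open>j = t - t'\<close> gives the shape of the
      hockey-stick identity.\<close>
    have "(\<Sum>t'\<le>t. card (shortest_paths d (t - t'))) = (\<Sum>j\<le>t. (d + j) choose j)"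
      by (rule sum.reindex_bij_witness[of _ "\<lambda>i. t - i" "\<lambda>i. t - i"])
        (auto simp: finite_card_shortest_paths)
    then show ?thesis by (simp add: sum_choose_lower)
  qed
  \<comment> \<open>The inner sum has the same shape as its own summand with \<open>d\<close> raised
    to \<open>Suc d\<close>, so the identity applies again; each application contributes one unit of
    the final \<open>+ 2\<close>.\<close>
  then have "(\<Sum>t\<le>T. \<Sum>t'\<le>t. card (shortest_paths d (t - t'))) = Suc (Suc d + T) choose T"
    by (simp only: sum_choose_lower)
  also have "Suc (Suc d + T) = T + d + 2" by simp
  finally show ?thesis
    unfolding mean_paths_def d_def[symmetric] atLeast0AtMost
    by (simp flip: of_nat_sum)
qed

lemma subexponential_poly_bound:
  assumes "eventually (\<lambda>n. \<bar>f n\<bar> \<le> real (n + k) ^ m) at_top"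
  shows "subexponential at_top (\<lambda>n. n) f"
  unfolding subexponential_def
proof (intro allI impI)
  fix c :: real assume c: "c > 1"
  have "f \<in> O(\<lambda>n. real (n + k) ^ m)"
    using assms by (intro bigoI[of _ 1]) simp
  also have "(\<lambda>n. real (n + k) ^ m) \<in> o(\<lambda>n. c ^ n)"
    using c by real_asymp
  finally show "f \<in> o(\<lambda>n. c ^ n)" .
qed

text \<open>Since \<open>a ^ m = a powr (- s) * (a powr r) ^ n\<close>, an affine change of
  parameter alters only a constant factor and the base, and the new base exceeds 1 because
  \<open>r > 0\<close>. This carries growth in \<open>T\<close> over to growth in
  \<open>L\<close>.\<close>

lemma exponential_affine:
  assumes "exponential F m f" and "r > 0"
    and ev: "eventually (\<lambda>x. real (m x) = r * real (n x) - s) F"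
  shows "exponential F n f"
proof -
  have \<Theta>: "(\<lambda>x. a ^ m x) \<in> \<Theta>[F](\<lambda>x. (a powr r) ^ n x)" if "a > 1" for a :: real
  proof -
    have "eventually (\<lambda>x. a ^ m x = a powr (- s) * (a powr r) ^ n x) F"
      using ev
    proof eventually_elim
      case (elim x)
      have "a ^ m x = a powr (r * real (n x) - s)"
        using that elim by (simp flip: powr_realpow)
      also have "\<dots> = a powr (- s) * (a powr r) ^ n x"
        using that by (simp add: powr_diff powr_minus field_simps powr_powr flip: powr_realpow)
      finally show ?case .
    qed
    then have "(\<lambda>x. a ^ m x) \<in> \<Theta>[F](\<lambda>x. a powr (- s) * (a powr r) ^ n x)"
      by (rule bigthetaI_cong)
    then show ?thesis using that by simp
  qed
  obtain a b where ab: "a > 1" "f \<in> \<Omega>[F](\<lambda>x. a ^ m x)" "b > 1" "f \<in> O[F](\<lambda>x. b ^ m x)"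
    using assms(1) by (auto simp: exponential_def)
  have "a powr r > 1" "b powr r > 1" using ab \<open>r > 0\<close> by (auto intro: gr_one_powr)
  moreover have "f \<in> \<Omega>[F](\<lambda>x. (a powr r) ^ n x)" "f \<in> O[F](\<lambda>x. (b powr r) ^ n x)"
    using ab \<Theta>[of a] \<Theta>[of b] landau_omega.big.cong_bigtheta landau_o.big.cong_bigtheta by blast+
  ultimately show ?thesis unfolding exponential_def by blast
qed

lemma filterlim_fst_same_rate: "filterlim fst at_top (same_rate l r)"
  unfolding filterlim_def same_rate_def
  by (rule order_trans[OF filtermap_mono[OF inf_le1] filtermap_fst_prod_filter])

lemma eventually_same_rate:
  assumes "r > 0"
  shows "eventually (\<lambda>(T, L). T \<ge> 1 \<and> l \<le> L \<and> real T = r * real (L - l)) (same_rate l r)"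
proof -
  have "eventually (\<lambda>x. fst x \<ge> 1) (same_rate l r)"
    using eventually_ge_at_top filterlim_fst_same_rate by (rule eventually_compose_filterlim)
  moreover have "eventually (\<lambda>(T, L). l \<le> L \<and> real T / real (L - l) = r) (same_rate l r)"
    unfolding same_rate_def eventually_inf_principal by simp
  ultimately show ?thesis
    \<comment> \<open>Division by zero gives 0, so a positive ratio forces \<open>L - l\<close> to
      be nonzero and the fraction can be cleared.\<close>
    by eventually_elim (use assms in \<open>auto simp: nonzero_divide_eq_eq zero_less_divide_iff simp del: of_nat_diff\<close>)
qed

lemma exponential_mean_paths:
  assumes "r > 0"
  shows "exponential (same_rate l r) (\<lambda>(T, L). T) (\<lambda>(T, L). mean_paths T L l)"
proof -
  define F where "F = same_rate l r"
  \<comment> \<open>The square root splits \<open>(1 + 1 / r) ^ T\<close> into two factors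
    \<open>a ^ T\<close>: one absorbs the division by \<open>T\<close>, the other remains as the
    lower bound.\<close>
  define a where "a = sqrt (1 + 1 / r)"
  have a: "a > 1" and a2: "a * a = 1 + 1 / r" using assms by (auto simp: a_def)
  have ev: "eventually (\<lambda>(T, L). T \<ge> 1 \<and> l \<le> L \<and> real T = r * real (L - l)) F"
    unfolding F_def by (rule eventually_same_rate) fact
  have "eventually (\<lambda>T. real T \<le> a ^ T) at_top" using a by real_asymp
  then have small: "eventually (\<lambda>x. real (fst x) \<le> a ^ fst x) F"
    unfolding F_def using filterlim_fst_same_rate by (rule eventually_compose_filterlim)
  have "eventually (\<lambda>x. a ^ fst x \<le> mean_paths (fst x) (snd x) l) F"
    using ev small
  proof eventually_elim
    case (elim x)
    obtain T L where x: "x = (T, L)" by fastforce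
    define d where "d = L - l"
    have T: "T \<ge> 1" "real T = r * real d" and aT: "real T \<le> a ^ T"
      using elim by (auto simp: x d_def)
    have "real T * a ^ T \<le> a ^ T * a ^ T"
      using aT a by (intro mult_right_mono) auto
    also have "\<dots> = (1 + 1 / r) ^ T"
      by (simp add: a2 flip: power_mult_distrib)
    \<comment> \<open>The quotient is \<open>1 + d / T + 2 / T\<close>, and
      \<open>d / T = 1 / r\<close>.\<close>
    also have "\<dots> \<le> (real (T + d + 2) / real T) ^ T"
      using T assms by (intro power_mono) (auto simp: field_simps)
    also have "\<dots> \<le> real ((T + d + 2) choose T)"
      using binomial_ge_n_over_k_pow_k[of T "T + d + 2", where 'a = real] by simp
    finally show ?case
      using T(1) by (simp add: x mean_paths_eq d_def field_simps)
  qed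
  then have lower: "(\<lambda>x. mean_paths (fst x) (snd x) l) \<in> \<Omega>[F](\<lambda>x. a ^ fst x)"
    using a by (intro landau_omega.bigI[of 1]) (auto elim!: eventually_mono)
  \<comment> \<open>Chosen so that \<open>b ^ T = 2 powr (T + d)\<close> when
    \<open>T = r * d\<close>; the \<open>+ 2\<close> in the binomial coefficient accounts for the
    constant 4 below.\<close>
  define b where "b = 2 powr (1 + 1 / r)"
  have b: "b > 1" using assms unfolding b_def by (intro gr_one_powr) (auto intro: add_pos_pos)
  have "eventually (\<lambda>x. norm (mean_paths (fst x) (snd x) l) \<le> 4 * norm (b ^ fst x)) F"
    using ev
  proof eventually_elim
    case (elim x)
    obtain T L where x: "x = (T, L)" by fastforce
    define d where "d = L - l"
    have T: "T \<ge> 1" "real T = r * real d" using elim by (auto simp: x d_def)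
    have "real ((T + d + 2) choose T) \<le> real (2 ^ (T + d + 2))"
      by (simp only: of_nat_le_iff binomial_le_pow2)
    also have "\<dots> = 4 * 2 powr (real T + real d)"
      by (simp add: powr_add powr_realpow power_add)
    also have "real T + real d = (1 + 1 / r) * real T"
      using T assms by (simp add: field_simps)
    also have "2 powr \<dots> = b ^ T"
      using b by (simp add: b_def powr_powr flip: powr_realpow)
    finally have "real ((T + d + 2) choose T) \<le> 4 * b ^ T" .
    moreover have "norm (mean_paths T L l) \<le> real ((T + d + 2) choose T)"
      using T(1) mult_left_mono[of 1 "real T" "real ((T + d + 2) choose T)"]
      by (simp add: mean_paths_eq d_def field_simps)
    ultimately show ?case using b by (simp add: x)
  qed
  then have "(\<lambda>x. mean_paths (fst x) (snd x) l) \<in> O[F](\<lambda>x. b ^ fst x)"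
    by (rule bigoI)
  with lower a b show ?thesis
    unfolding exponential_def F_def case_prod_unfold by blast
qed

theorem lemma2:
  "(\<forall>T L l :: nat. 1 \<le> T \<and> l \<le> L \<longrightarrow>
      mean_paths T L l = 1 / real T * real ((T + (L - l) + 2) choose T)) \<and>
   (\<forall>L l :: nat. l \<le> L \<longrightarrow> subexponential at_top (\<lambda>T. T) (\<lambda>T. mean_paths T L l)) \<and>
   (\<forall>T l :: nat. 1 \<le> T \<longrightarrow> subexponential at_top (\<lambda>L. L) (\<lambda>L. mean_paths T L l)) \<and>
   (\<forall>l :: nat. \<forall>r :: real. 0 < r \<longrightarrow>
      exponential (same_rate l r) (\<lambda>(T, L). T) (\<lambda>(T, L). mean_paths T L l) \<and>
      exponential (same_rate l r) (\<lambda>(T, L). L) (\<lambda>(T, L). mean_paths T L l))"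
proof (intro conjI allI impI)
  fix T L l :: nat
  show "mean_paths T L l = 1 / real T * real ((T + (L - l) + 2) choose T)"
    by (rule mean_paths_eq)
next
  have bound: "\<bar>mean_paths T L l\<bar> \<le> real ((T + (L - l) + 2) choose T)" if "T \<ge> 1" for T L l
    using that mult_left_mono[of 1 "real T" "real ((T + (L - l) + 2) choose T)"]
    by (simp add: mean_paths_eq field_simps)
  show "subexponential at_top (\<lambda>T. T) (\<lambda>T. mean_paths T L l)" for L l
  proof (rule subexponential_poly_bound)
    define d where "d = L - l"
    show "eventually (\<lambda>T. \<bar>mean_paths T L l\<bar> \<le> real (T + (d + 2)) ^ (d + 2)) at_top"
      using eventually_ge_at_top[of 1]
    proof eventually_elim
      case (elim T)
      \<comment> \<open>Symmetry moves the fixed number \<open>d + 2\<close> into the lower index,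
        which makes the power bound polynomial in \<open>T\<close>.\<close>
      have "(T + d + 2) choose T = (T + d + 2) choose (d + 2)"
        by (subst binomial_symmetric) auto
      also have "\<dots> \<le> (T + d + 2) ^ (d + 2)" by (intro binomial_le_pow) simp
      finally have "real ((T + d + 2) choose T) \<le> real (T + (d + 2)) ^ (d + 2)"
        by (simp only: of_nat_le_iff add.assoc flip: of_nat_power)
      with bound[OF elim, of L l] show ?case unfolding d_def by (rule order_trans)
    qed
  qed
  show "subexponential at_top (\<lambda>L. L) (\<lambda>L. mean_paths T L l)" if "1 \<le> T" for T l
  proof (rule subexponential_poly_bound[OF always_eventually], rule allI)
    fix L
    \<comment> \<open>Here the lower index \<open>T\<close> is itself fixed, so the power bound is
      already polynomial in \<open>L\<close>.\<close>
    have "(T + (L - l) + 2) choose T \<le> (T + (L - l) + 2) ^ T" by (intro binomial_le_pow) simp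
    also have "\<dots> \<le> (L + (T + 2)) ^ T" by (intro power_mono) auto
    finally have "real ((T + (L - l) + 2) choose T) \<le> real ((L + (T + 2)) ^ T)"
      by (simp only: of_nat_le_iff)
    with bound[OF that, of L l] show "\<bar>mean_paths T L l\<bar> \<le> real (L + (T + 2)) ^ T" by simp
  qed
  fix l :: nat and r :: real assume "0 < r"
  then show exp_T: "exponential (same_rate l r) (\<lambda>(T, L). T) (\<lambda>(T, L). mean_paths T L l)"
    by (rule exponential_mean_paths)
  show "exponential (same_rate l r) (\<lambda>(T, L). L) (\<lambda>(T, L). mean_paths T L l)"
  \<comment> \<open>The relation \<open>T = r * (L - l)\<close> is affine in \<open>L\<close>, with
    offset \<open>s = r * l\<close>.\<close>
  proof (rule exponential_affine[OF exp_T \<open>0 < r\<close>])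
    show "eventually (\<lambda>x. real (case x of (T, L) \<Rightarrow> T) = r * real (case x of (T, L) \<Rightarrow> L) - r * real l)
        (same_rate l r)"
      using eventually_same_rate[OF \<open>0 < r\<close>, of l]
      by eventually_elim (auto simp: of_nat_diff algebra_simps)
  qed
qed

end
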